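(* Let $G$ be a finite abelian group and let $D=\mathrm{Dih}(G)=\langle G,x\rangle$. Let $S\subseteq D$ be closed under inversion, and let $\Gamma=\mathrm{Cay}(D,S)$. Suppose that there exist an integer $k\ge 0$, an element $c\in G$ of order $2^k$ and a subgroup $A\le G$ such that $G$ is the internal direct product $G=\langle c\rangle\times A$. If there exists some $y\in xG$ such that for every $g\in G$ we have $yg\in S\cap xG$ if and only if $yg^{-1}c\in S\cap xG$, then $\Gamma$ is a Cayley graph on the abelian group $C_{2^{k+1}}\times A$.
   Context: For a group $K$ and a subset $S\subseteq K$ closed under inversion ($S=S^{-1}$), the Cayley graph $\mathrm{Cay}(K,S)$ is the (undirected) graph with vertex set $K$ in which $u$ and $v$ are adjacent if and only if $v=su$ for some $s\in S$. (The identity is usually omitted from $S$ to avoid loops.) A graph $\Gamma$ is said to be a Cayley graph on a group $K$ if $\Gamma$ is isomorphic to $\mathrm{Cay}(K,T)$ for some inverse-closed $T\subseteq K$; equivalently, $\mathrm{Aut}(\Gamma)$ contains a subgroup isomorphic to $K$ acting regularly on $V(\Gamma)$. For an abelian group $G$, the generalized dihedral group is $\mathrm{Dih}(G)=\langle G,x\rangle$, where $x\notin G$, $x^2=1$ and $gx=xg^{-1}$ for every $g\in G$; that is, the semidirect product of $G$ with a group $\langle x\rangle$ of order $2$ acting by inversion, so that $G$ has index $2$ in $\mathrm{Dih}(G)$ and $xG$ is its other coset. $C_n$ denotes the cyclic group of order $n$. *)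

theory Defs
  imports "HOL-Algebra.Algebra" "Graph_Theory.Graph_Theory"
begin

text \<open>
  As usual in \<^verbatim>\<open>Graph_Theory\<close>, an undirected graph is a symmetric digraph: the edge
  joining \<open>u\<close> and \<open>v\<close> is represented by both arcs \<open>(u, v)\<close> and \<open>(v, u)\<close>. The connection set
  may contain the identity, in which case every vertex carries a loop.
\<close>

definition Cay :: "('a, 'b) monoid_scheme \<Rightarrow> 'a set \<Rightarrow> 'a pair_pre_digraph" where
  "Cay K S =
    \<lparr>pverts = carrier K,
     parcs = {(u, v). u \<in> carrier K \<and> v \<in> carrier K \<and> (\<exists>s\<in>S. v = s \<otimes>\<^bsub>K\<^esub> u)}\<rparr>"

lemma pair_sym_digraph_Cay:
  assumes "group K" and S: "S \<subseteq> carrier K" and inv: "set_inv\<^bsub>K\<^esub> S = S"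
  shows "pair_sym_digraph (Cay K S)"
proof -
  interpret group K by fact
  have "(v, u) \<in> parcs (Cay K S)" if uv: "(u, v) \<in> parcs (Cay K S)" for u v
  proof -
    obtain s where s: "s \<in> S" "v = s \<otimes>\<^bsub>K\<^esub> u" and u: "u \<in> carrier K"
      using uv by (auto simp: Cay_def)
    have "u = inv\<^bsub>K\<^esub> s \<otimes>\<^bsub>K\<^esub> v"
      using s u S by (metis inv_solve_left subsetD m_closed)
    moreover have "inv\<^bsub>K\<^esub> s \<in> S"
      using s(1) inv by (auto simp: SET_INV_def)
    ultimately show ?thesis
      using uv by (auto simp: Cay_def)
  qed
  then show ?thesis
    by unfold_locales (auto simp: symmetric_def sym_def, auto simp: Cay_def)
qed

text \<open>
  No two arcs of these digraphs are parallel, so \<^const>\<open>digraph_iso\<close> says precisely that there is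
  a bijection of the vertex sets preserving adjacency and non-adjacency.
\<close>

definition Cayley_graph_on :: "'v pair_pre_digraph \<Rightarrow> ('a, 'b) monoid_scheme \<Rightarrow> bool" where
  "Cayley_graph_on \<Gamma> K \<longleftrightarrow> group K \<and>
    (\<exists>T. T \<subseteq> carrier K \<and> set_inv\<^bsub>K\<^esub> T = T \<and>
         digraph_iso (with_proj \<Gamma>) (with_proj (Cay K T)))"

text \<open>
  \<open>D\<close> is the generalized dihedral group \<open>\<langle>G, x\<rangle>\<close> of its abelian subgroup \<open>G\<close>. This is stated
  internally, so \<open>D\<close> ranges over all realizations of \<open>Dih(G)\<close> containing \<open>G\<close>.
\<close>

locale generalized_dihedral = group D + subgroup G D
  for D :: "('a, 'b) monoid_scheme" (structure) and G and x +
  assumes abelian: "comm_group (D\<lparr>carrier := G\<rparr>)"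
    and x_carrier: "x \<in> carrier D"
    and x_notin: "x \<notin> G"
    and x_square: "x \<otimes> x = \<one>"
    and x_inverts: "\<And>g. g \<in> G \<Longrightarrow> g \<otimes> x = x \<otimes> inv g"
    and generates: "generate D (insert x G) = carrier D"

text \<open>
  The semidirect product of \<open>H\<close> with a group of order 2 acting by inversion is such a realization,
  with \<open>(h, True)\<close> in the role of \<open>hx\<close>.
\<close>

lemma (in comm_group) generalized_dihedral_semidirect:
  "generalized_dihedral
     \<lparr>carrier = carrier G \<times> (UNIV :: bool set),
      monoid.mult = (\<lambda>(g, a) (h, b). (g \<otimes> (if a then inv h else h), a \<noteq> b)),
      one = (\<one>, False)\<rparr>
     (carrier G \<times> {False}) (\<one>, True)"
    (is "generalized_dihedral ?D ?G ?x")
proof -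
  define D where "D = ?D"
  have [simp]: "carrier D = carrier G \<times> UNIV" "\<one>\<^bsub>D\<^esub> = (\<one>, False)"
    "\<And>g a h b. (g, a) \<otimes>\<^bsub>D\<^esub> (h, b) = (g \<otimes> (if a then inv h else h), a \<noteq> b)"
    by (simp_all add: D_def)
  have grp: "group D"
  proof (rule groupI)
    fix p assume "p \<in> carrier D"
    then obtain g a where p: "p = (g, a)" "g \<in> carrier G" by auto
    show "\<exists>q\<in>carrier D. q \<otimes>\<^bsub>D\<^esub> p = \<one>\<^bsub>D\<^esub>"
      using p by (intro bexI[of _ "(if a then g else inv g, a)"]) auto
  qed (auto simp: m_assoc inv_mult m_comm)
  interpret D: group D by (rule grp)
  have inv: "inv\<^bsub>D\<^esub> (g, False) = (inv g, False)" if "g \<in> carrier G" for g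
    using that by (intro D.inv_equality) auto
  have sub: "subgroup ?G D"
    by (rule D.subgroupI) (auto simp: inv)
  have ab: "comm_group (D\<lparr>carrier := ?G\<rparr>)"
    by (rule group.group_comm_groupI[OF D.subgroup_imp_group[OF sub]]) (auto simp: m_comm)
  have "p \<in> generate D (insert ?x ?G)" if p: "p \<in> carrier D" for p
  proof -
    obtain g a where ga: "p = (g, a)" "g \<in> carrier G" using p by auto
    have g: "(g, False) \<in> generate D (insert ?x ?G)"
      using ga by (intro generate.incl) auto
    have x: "?x \<in> generate D (insert ?x ?G)"
      by (intro generate.incl) auto
    show ?thesis
      using generate.eng[OF g x] g ga by (cases a) auto
  qed
  moreover have "generate D (insert ?x ?G) \<subseteq> carrier D"
    by (rule D.generate_incl) auto
  ultimately have gen: "generate D (insert ?x ?G) = carrier D" by blast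
  have "generalized_dihedral D ?G ?x"
    by (intro generalized_dihedral.intro generalized_dihedral_axioms.intro grp sub ab gen)
      (auto simp: inv)
  then show ?thesis by (simp only: D_def)
qed

definition internal_direct_product :: "('a, 'b) monoid_scheme \<Rightarrow> 'a set \<Rightarrow> 'a set \<Rightarrow> bool" where
  "internal_direct_product G H K \<longleftrightarrow>
    H \<lhd> G \<and> K \<lhd> G \<and> H <#>\<^bsub>G\<^esub> K = carrier G \<and> H \<inter> K = {\<one>\<^bsub>G\<^esub>}"

end

theory Submission
  imports Defs
begin

text \<open>
  All elements of \<open>xG\<close> are involutions inverting \<open>G\<close>, so we may take \<open>x = y\<close>. The permutation
  \<open>g \<mapsto> ygc\<close>, \<open>yg \<mapsto> g\<close> of \<open>D\<close> maps an arc \<open>g \<rightarrow> yrg\<close> to \<open>ygc \<rightarrow> rg\<close>; since \<open>rg = y(r\<inverse>c)(ygc)\<close>, the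
  hypothesis on \<open>S\<close> makes it an automorphism of the Cayley graph. Its square is the right translation
  by \<open>c\<close> and it commutes with the right translations by \<open>A\<close>, so together with these it generates a regular
  group \<open>C\<^bsub>2^(k+1)\<^esub> \<times> A\<close>.
\<close>

section \<open>Graph isomorphisms and a criterion for being a Cayley graph\<close>

text \<open>An arc is the pair of its ends, so the vertex map \<open>h\<close> determines the arc
  map \<open>map_prod h h\<close>; injectivity on arcs is inherited from \<open>h\<close>.\<close>

lemma digraph_iso_with_projI:
  fixes \<Gamma> :: "'v pair_pre_digraph" and \<Delta> :: "'w pair_pre_digraph"
  assumes wf: "wf_digraph (with_proj \<Gamma>)"
    and bij: "bij_betw h (pverts \<Gamma>) (pverts \<Delta>)"
    and arcs: "\<And>u v. u \<in> pverts \<Gamma> \<Longrightarrow> v \<in> pverts \<Gamma> \<Longrightarrow> (u, v) \<in> parcs \<Gamma> \<longleftrightarrow> (h u, h v) \<in> parcs \<Delta>"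
    and wf': "parcs \<Delta> \<subseteq> pverts \<Delta> \<times> pverts \<Delta>"
  shows "digraph_iso (with_proj \<Gamma>) (with_proj \<Delta>)"
proof -
  interpret wf_digraph "with_proj \<Gamma>" by (rule wf)
  have in_verts: "u \<in> pverts \<Gamma>" "v \<in> pverts \<Gamma>" if "(u, v) \<in> parcs \<Gamma>" for u v
    using that tail_in_verts[of "(u, v)"] head_in_verts[of "(u, v)"] by auto
  have inj: "inj_on h (pverts \<Gamma>)" and img: "h ` pverts \<Gamma> = pverts \<Delta>"
    using bij by (auto simp: bij_betw_def)
  define hom where
    "hom = \<lparr>iso_verts = h, iso_arcs = map_prod h h, iso_head = snd, iso_tail = fst\<rparr>"
  have "inj_on (map_prod h h) (parcs \<Gamma>)"
    by (rule inj_onI) (clarsimp, metis in_verts inj inj_onD)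
  then have "digraph_isomorphism hom"
    unfolding digraph_isomorphism_def using inj wf by (auto simp: hom_def)
  moreover have "map_prod h h ` parcs \<Gamma> = parcs \<Delta>"
  proof (intro equalityI subrelI)
    fix u' v' assume "(u', v') \<in> map_prod h h ` parcs \<Gamma>"
    then obtain u v where uv: "(u, v) \<in> parcs \<Gamma>" "u' = h u" "v' = h v"
      by auto
    then show "(u', v') \<in> parcs \<Delta>"
      using arcs[of u v] in_verts[OF uv(1)] by simp
  next
    fix u' v' assume uv': "(u', v') \<in> parcs \<Delta>"
    then obtain u v where "u \<in> pverts \<Gamma>" "v \<in> pverts \<Gamma>" "u' = h u" "v' = h v"
      using wf' img by blast
    then show "(u', v') \<in> map_prod h h ` parcs \<Gamma>"
      using uv' arcs by (auto intro!: image_eqI[of _ _ "(u, v)"])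
  qed
  then have "with_proj \<Delta> = app_iso hom (with_proj \<Gamma>)"
    using img by (simp add: app_iso_def hom_def with_proj_def)
  ultimately show ?thesis
    unfolding digraph_iso_def by blast
qed

text \<open>This is regularity of a group of automorphisms, written without permutations:
  \<open>f\<close> plays the role of the orbit map of the identity vertex. Adjacency of
  \<open>u\<close> and \<open>v\<close> depends only on the quotient \<open>v u^-1\<close>, and
  \<open>diff\<close> says that \<open>f\<close> carries this criterion from \<open>K\<close> to
  \<open>D\<close>.\<close>

lemma Cayley_graph_onI:
  fixes D :: "('a, 'b) monoid_scheme" and K :: "('c, 'd) monoid_scheme"
  assumes "group D" "group K"
    and S: "S \<subseteq> carrier D" "set_inv\<^bsub>D\<^esub> S = S"
    and bij: "bij_betw f (carrier K) (carrier D)"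
    and one: "f \<one>\<^bsub>K\<^esub> = \<one>\<^bsub>D\<^esub>"
    and diff: "\<And>u v. u \<in> carrier K \<Longrightarrow> v \<in> carrier K \<Longrightarrow>
      f v \<otimes>\<^bsub>D\<^esub> inv\<^bsub>D\<^esub> f u \<in> S \<longleftrightarrow> f (v \<otimes>\<^bsub>K\<^esub> inv\<^bsub>K\<^esub> u) \<in> S"
  shows "Cayley_graph_on (Cay D S) K"
proof -
  interpret D: group D by fact
  interpret K: group K by fact
  \<comment> \<open>The connection set is the pullback of \<open>S\<close> along \<open>f\<close>.
    The isomorphism has to run from the graph on \<open>D\<close> to the graph on \<open>K\<close>,
    hence the inverse \<open>h\<close> of \<open>f\<close>.\<close>
  define T where "T = {t \<in> carrier K. f t \<in> S}"
  define h where "h = inv_into (carrier K) f"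
  \<comment> \<open>The only \<open>s\<close> with \<open>v = s u\<close> is \<open>v u^-1\<close>.
    The group \<open>L\<close> is arbitrary because the fact serves for both \<open>D\<close> and
    \<open>K\<close>.\<close>
  have arc_iff: "(u, v) \<in> parcs (Cay L R) \<longleftrightarrow> v \<otimes>\<^bsub>L\<^esub> inv\<^bsub>L\<^esub> u \<in> R"
    if "group L" "R \<subseteq> carrier L" "u \<in> carrier L" "v \<in> carrier L"
    for L :: "('e, 'f) monoid_scheme" and R u v
  proof -
    interpret L: group L by fact
    show ?thesis
      using that by (auto simp: Cay_def L.m_assoc subset_iff intro!: bexI[of _ "v \<otimes>\<^bsub>L\<^esub> inv\<^bsub>L\<^esub> u"])
  qed
  have f: "f t \<in> carrier D" if "t \<in> carrier K" for t
    using that bij by (auto simp: bij_betw_def)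
  have S_inv: "inv\<^bsub>D\<^esub> s \<in> S" if "s \<in> S" for s
    using that S(2) by (auto simp: SET_INV_def)
  \<comment> \<open>Taking \<open>v\<close> to be the identity in \<open>diff\<close> compares the
    inverse of \<open>f t\<close> with \<open>f\<close> of the inverse of \<open>t\<close>; here
    \<open>one\<close> enters.\<close>
  have T_inv: "inv\<^bsub>K\<^esub> t \<in> T" if "t \<in> T" for t
    using that diff[of t "\<one>\<^bsub>K\<^esub>"] S_inv f[of t] by (auto simp: T_def one)
  have T: "T \<subseteq> carrier K"
    by (auto simp: T_def)
  have T_set_inv: "set_inv\<^bsub>K\<^esub> T = T"
  proof
    show "set_inv\<^bsub>K\<^esub> T \<subseteq> T"
      using T_inv by (auto simp: SET_INV_def)
    show "T \<subseteq> set_inv\<^bsub>K\<^esub> T"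
    proof
      fix t assume "t \<in> T"
      then have "inv\<^bsub>K\<^esub> t \<in> T" "t = inv\<^bsub>K\<^esub> (inv\<^bsub>K\<^esub> t)"
        using T_inv T by auto
      then show "t \<in> set_inv\<^bsub>K\<^esub> T"
        unfolding SET_INV_def by blast
    qed
  qed
  interpret \<Gamma>: pair_sym_digraph "Cay D S"
    by (rule pair_sym_digraph_Cay) (use assms in auto)
  have "digraph_iso (with_proj (Cay D S)) (with_proj (Cay K T))"
  proof (rule digraph_iso_with_projI)
    show "wf_digraph (with_proj (Cay D S))"
      by unfold_locales
    show "bij_betw h (pverts (Cay D S)) (pverts (Cay K T))"
      using bij_betw_inv_into[OF bij] by (simp add: Cay_def h_def)
    show "parcs (Cay K T) \<subseteq> pverts (Cay K T) \<times> pverts (Cay K T)"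
      by (auto simp: Cay_def)
    fix u v assume "u \<in> pverts (Cay D S)" "v \<in> pverts (Cay D S)"
    then have uv: "u \<in> carrier D" "v \<in> carrier D"
      by (auto simp: Cay_def)
    have h: "h w \<in> carrier K" "f (h w) = w" if "w \<in> carrier D" for w
      using that bij by (auto simp: h_def bij_betw_def inv_into_into f_inv_into_f)
    show "(u, v) \<in> parcs (Cay D S) \<longleftrightarrow> (h u, h v) \<in> parcs (Cay K T)"
      using diff[of "h u" "h v"] h[OF uv(1)] h[OF uv(2)] uv S(1) T
      by (simp add: arc_iff D.is_group K.is_group) (simp add: T_def)
  qed
  then show ?thesis
    unfolding Cayley_graph_on_def using K.is_group T T_set_inv by blast
qed

section \<open>The two cosets of \<open>G\<close> in the generalized dihedral group\<close>

context generalized_dihedral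
begin

lemma G_comm: "g \<in> G \<Longrightarrow> h \<in> G \<Longrightarrow> g \<otimes> h = h \<otimes> g"
  using comm_group.axioms(1)[OF abelian] comm_monoid.m_comm[of "D\<lparr>carrier := G\<rparr>" g h] by simp

lemma x_mult_notin: "g \<in> G \<Longrightarrow> x \<otimes> g \<notin> G"
  using x_notin x_carrier mem_carrier m_closed m_inv_closed inv_solve_right' by metis

lemma x_mult_x: "g \<in> G \<Longrightarrow> x \<otimes> (g \<otimes> x) = inv g"
  using x_square x_carrier mem_carrier by (simp add: x_inverts flip: m_assoc)

lemma inv_x_mult:
  assumes "g \<in> G"
  shows "inv (x \<otimes> g) = x \<otimes> g"
proof (rule inv_equality)
  have "x \<otimes> g \<otimes> (x \<otimes> g) = x \<otimes> (g \<otimes> x) \<otimes> g"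
    using assms x_carrier by (simp add: m_assoc)
  then show "x \<otimes> g \<otimes> (x \<otimes> g) = \<one>"
    using assms by (simp add: x_mult_x)
qed (use assms x_carrier in auto)

text \<open>The union of \<open>G\<close> and \<open>x G\<close> contains the generators and their
  inverses and is closed under products, since moving \<open>x\<close> past an element of
  \<open>G\<close> inverts it and \<open>x\<close> squares to the identity.\<close>

lemma carrier_cases:
  assumes "d \<in> carrier D"
  obtains (rotation) "d \<in> G" | (reflection) g where "g \<in> G" "d = x \<otimes> g"
proof -
  have "d \<in> generate D (insert x G)"
    using assms by (simp add: generates)
  then have "d \<in> G \<or> (\<exists>g\<in>G. d = x \<otimes> g)"
  proof (induction rule: generate.induct)
    case (incl h)
    then show ?case using x_carrier by (auto intro!: bexI[of _ \<one>])
  next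
    case (inv h)
    have "inv x = x" using x_square x_carrier by (simp add: inv_equality)
    with inv show ?case using x_carrier by (auto intro!: bexI[of _ \<one>])
  next
    case (eng h1 h2)
    have "g \<otimes> (x \<otimes> h) = x \<otimes> (inv g \<otimes> h)" if "g \<in> G" "h \<in> G" for g h
      using that x_inverts x_carrier mem_carrier by (simp flip: m_assoc)
    moreover have "x \<otimes> g \<otimes> (x \<otimes> h) = inv g \<otimes> h" if "g \<in> G" "h \<in> G" for g h
      using that x_mult_x[of g] x_carrier mem_carrier by (simp add: m_assoc) (simp flip: m_assoc)
    moreover have "x \<otimes> g \<otimes> h = x \<otimes> (g \<otimes> h)" if "g \<in> G" "h \<in> G" for g h
      using that x_carrier mem_carrier by (simp add: m_assoc)
    ultimately show ?case
      using eng.IH by (smt (verit) m_closed m_inv_closed)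
  qed auto
  then show thesis using that by blast
qed

text \<open>With \<open>y = x g\<close>, the factor \<open>g\<close> commutes with \<open>G\<close>,
  so \<open>y\<close> inverts \<open>G\<close> just as \<open>x\<close> does; and
  \<open>x = y g^-1\<close> lies in the subgroup generated by \<open>y\<close> and
  \<open>G\<close>.\<close>

lemma generalized_dihedral_coset:
  assumes "y \<in> x <# G"
  shows "generalized_dihedral D G y"
proof -
  obtain g where g: "g \<in> G" "y = x \<otimes> g"
    using assms by (auto simp: l_coset_def)
  have y: "y \<in> carrier D"
    using g x_carrier mem_carrier by simp
  have x: "x = y \<otimes> inv g"
    using g x_carrier mem_carrier by (simp add: m_assoc)
  have "y \<otimes> y = \<one>"
    using inv_x_mult[of g] g y by (metis r_inv)
  moreover have "h \<otimes> y = y \<otimes> inv h" if h: "h \<in> G" for h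
    using h g x_carrier mem_carrier x_inverts[OF h] G_comm[of g "inv h"]
    by (simp add: m_assoc) (simp flip: m_assoc)
  moreover have "carrier D \<subseteq> generate D (insert y G)"
  proof
    fix d assume d: "d \<in> carrier D"
    have G_incl: "h \<in> generate D (insert y G)" if "h \<in> G" for h
      using that by (simp add: generate.incl)
    have y_incl: "y \<in> generate D (insert y G)"
      by (simp add: generate.incl)
    from d show "d \<in> generate D (insert y G)"
    proof (cases rule: carrier_cases)
      case (reflection h)
      have "y \<otimes> inv g \<otimes> h \<in> generate D (insert y G)"
        using g reflection by (intro generate.eng y_incl G_incl) auto
      then show ?thesis
        using reflection by (simp flip: x)
    qed (rule G_incl)
  qed
  moreover have "generate D (insert y G) \<subseteq> carrier D"
    using y subset by (intro generate_incl) auto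
  ultimately show ?thesis
    using y g x_mult_notin abelian
    by (intro generalized_dihedral.intro generalized_dihedral_axioms.intro is_group subgroup_axioms)
      auto
qed

text \<open>
  The image of \<open>\<one>\<close> under the \<open>i\<close>-th power of the permutation \<open>g \<mapsto> xgc\<close>, \<open>xg \<mapsto> g\<close> followed by right
  translation by \<open>a\<close>.
\<close>

definition param :: "'a \<Rightarrow> int \<times> 'a \<Rightarrow> 'a" where
  "param c = (\<lambda>(i, a). if even i then c [^] (i div 2) \<otimes> a else x \<otimes> (c [^] (i div 2 + 1) \<otimes> a))"

lemma param_even: "param c (2 * m, a) = c [^] m \<otimes> a"
  by (simp add: param_def)

text \<open>The permutation picks up a factor \<open>c\<close> when it leaves \<open>G\<close> and
  none when it returns. After \<open>2 * m + 1\<close> applications to the identity the exponent is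
  therefore \<open>m + 1\<close>.\<close>

lemma param_odd: "param c (2 * m + 1, a) = x \<otimes> (c [^] (m + 1) \<otimes> a)"
  by (simp add: param_def)

section \<open>Quotients of parametrized elements, periodicity and bijectivity of
  \<open>param\<close>\<close>

lemma G_int_pow: "c \<in> G \<Longrightarrow> c [^] (m :: int) \<in> G"
  using subgroup_int_pow_closed[OF subgroup_axioms] .

lemma mult_inv_int_pow:
  assumes "c \<in> G" "a \<in> G" "b \<in> G"
  shows "c [^] m \<otimes> a \<otimes> inv (c [^] n \<otimes> b) = c [^] (m - n :: int) \<otimes> (a \<otimes> inv b)"
proof -
  have "c [^] m \<otimes> a \<otimes> inv (c [^] n \<otimes> b) = c [^] m \<otimes> (a \<otimes> inv b \<otimes> inv (c [^] n))"
    using assms by (simp add: G_int_pow inv_mult_group m_assoc)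
  also have "\<dots> = c [^] m \<otimes> (inv (c [^] n) \<otimes> (a \<otimes> inv b))"
    using assms by (simp add: G_int_pow G_comm[of "a \<otimes> inv b"])
  also have "\<dots> = c [^] (m - n) \<otimes> (a \<otimes> inv b)"
    using assms by (simp add: G_int_pow int_pow_diff m_assoc)
  finally show ?thesis .
qed

text \<open>The quotient on the left is compared with the \<open>param\<close> value on the right by
  the parities of \<open>i\<close> and \<open>j\<close>. They coincide if \<open>j\<close> is even
  and \<open>i\<close> is arbitrary; they are mutually inverse if both are odd; for \<open>i\<close>
  even and \<open>j\<close> odd they are the two elements paired by \<open>hyp\<close>.\<close>

lemma param_diff_mem_iff:
  assumes S: "set_inv S = S"
    and hyp: "\<And>g. g \<in> G \<Longrightarrow> x \<otimes> g \<in> S \<longleftrightarrow> x \<otimes> inv g \<otimes> c \<in> S"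
    and c: "c \<in> G" and a: "a \<in> G" and b: "b \<in> G"
  shows "param c (i, a) \<otimes> inv param c (j, b) \<in> S \<longleftrightarrow> param c (i - j, a \<otimes> inv b) \<in> S"
proof -
  define m n where "m = i div 2" and "n = j div 2"
  have P: "c [^] l \<otimes> d \<in> G" if "d \<in> G" for l :: int and d
    using that c by (simp add: G_int_pow)
  note [simp] = x_carrier
  have "i = 2 * m \<or> i = 2 * m + 1" "j = 2 * n \<or> j = 2 * n + 1"
    unfolding m_def n_def by presburger+
  then consider "i = 2 * m" "j = 2 * n" | "i = 2 * m + 1" "j = 2 * n"
    | "i = 2 * m + 1" "j = 2 * n + 1" | "i = 2 * m" "j = 2 * n + 1"
    by blast
  then show ?thesis
  proof cases
    case 1
    then have ij: "i - j = 2 * (m - n)" by simp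
    show ?thesis
      unfolding ij unfolding 1 using c a b by (simp only: param_even mult_inv_int_pow)
  next
    case 2
    then have ij: "i - j = 2 * (m - n) + 1" by simp
    have "x \<otimes> (c [^] (m + 1) \<otimes> a) \<otimes> inv (c [^] n \<otimes> b)
        = x \<otimes> (c [^] (m + 1) \<otimes> a \<otimes> inv (c [^] n \<otimes> b))"
      using P[OF a] P[OF b] by (simp only: m_assoc x_carrier mem_carrier m_inv_closed)
    also have "\<dots> = x \<otimes> (c [^] (m - n + 1) \<otimes> (a \<otimes> inv b))"
      using c a b by (simp add: mult_inv_int_pow algebra_simps)
    finally show ?thesis
      unfolding ij unfolding 2 by (simp only: param_even param_odd)
  next
    case 3
    then have ij: "i - j = 2 * (m - n)" by simp
    define r where "r = c [^] (m - n) \<otimes> (a \<otimes> inv b)"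
    have r: "r \<in> G"
      using a b P by (simp add: r_def)
    define p q where "p = c [^] (m + 1) \<otimes> a" and "q = c [^] (n + 1) \<otimes> b"
    have pq: "p \<in> G" "q \<in> G"
      using a b P by (simp_all add: p_def q_def)
    have pq_r: "p \<otimes> inv q = r"
      using c a b by (simp add: mult_inv_int_pow p_def q_def r_def)
    \<comment> \<open>The reflection \<open>x q\<close> is its own inverse and conjugation by
      \<open>x\<close> inverts \<open>p\<close>. The quotient becomes \<open>inv r\<close>, and
      closure of \<open>S\<close> under inversion replaces it by \<open>r\<close>.\<close>
    have "x \<otimes> p \<otimes> inv (x \<otimes> q) = x \<otimes> (p \<otimes> x \<otimes> q)"
      using pq by (simp add: inv_x_mult m_assoc)
    also have "\<dots> = inv p \<otimes> q"
      using pq x_mult_x[of p] by (simp flip: m_assoc)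
    also have "\<dots> = inv r"
      using pq G_comm[of "inv p" q] by (simp add: inv_mult_group flip: pq_r)
    finally have "param c (i, a) \<otimes> inv param c (j, b) = inv r"
      using 3 by (simp only: param_odd p_def q_def)
    moreover have "inv s \<in> S" if "s \<in> S" for s
      using that S by (auto simp: SET_INV_def)
    then have "inv r \<in> S \<longleftrightarrow> r \<in> S"
      using r by (metis inv_inv mem_carrier)
    ultimately show ?thesis
      by (simp only: ij param_even r_def)
  next
    case 4
    \<comment> \<open>Because of the borrow, \<open>param_odd\<close> gives the exponent
      \<open>m - n\<close>, whereas \<open>p q^-1\<close> has exponent \<open>m - n - 1\<close>. The
      missing factor is the \<open>c\<close> in \<open>hyp\<close>.\<close>
    then have ij: "i - j = 2 * (m - n - 1) + 1" by simp
    define p q where "p = c [^] m \<otimes> a" and "q = c [^] (n + 1) \<otimes> b"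
    have pq: "p \<in> G" "q \<in> G"
      using a b P by (simp_all add: p_def q_def)
    define r where "r = inv p \<otimes> q"
    have r: "r \<in> G"
      using pq by (simp add: r_def)
    have "p \<otimes> inv (x \<otimes> q) = x \<otimes> r"
      using pq x_inverts[of p] by (simp add: inv_x_mult r_def flip: m_assoc)
    then have "param c (i, a) \<otimes> inv param c (j, b) = x \<otimes> r"
      using 4 by (simp only: param_even param_odd p_def q_def)
    moreover have "x \<otimes> inv r \<otimes> c = param c (i - j, a \<otimes> inv b)"
    proof -
      have "inv r = p \<otimes> inv q"
        using pq G_comm[of "inv q" p] by (simp add: r_def inv_mult_group)
      also have "\<dots> = c [^] (m - n - 1) \<otimes> (a \<otimes> inv b)"
        using c a b by (simp add: mult_inv_int_pow p_def q_def algebra_simps)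
      finally have "c \<otimes> inv r = c \<otimes> c [^] (m - n - 1) \<otimes> (a \<otimes> inv b)"
        using c a b by (simp add: G_int_pow m_assoc)
      also have "c \<otimes> c [^] (m - n - 1) = c [^] (m - n)"
        using c int_pow_mult[of c 1 "m - n - 1"] by simp
      finally have "inv r \<otimes> c = c [^] (m - n) \<otimes> (a \<otimes> inv b)"
        using c r G_comm[of c "inv r"] by simp
      then show ?thesis
        using c r unfolding ij param_odd by (simp add: m_assoc)
    qed
    ultimately show ?thesis
      using hyp[OF r] by simp
  qed
qed

text \<open>Shifting \<open>i\<close> by a multiple of \<open>2 n\<close> keeps its parity and
  changes \<open>i div 2\<close> by a multiple of the order of \<open>c\<close>. Thus
  \<open>param c\<close> depends only on the class of \<open>i\<close> modulo
  \<open>2 n\<close>.\<close>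

lemma param_mod:
  assumes "c \<in> G" "ord c = n"
  shows "param c (i mod (2 * int n), a) = param c (i, a)"
proof -
  define q where "q = i div (2 * int n)"
  have i: "i mod (2 * int n) = i - 2 * (int n * q)"
    by (simp add: q_def minus_mult_div_eq_mod [symmetric] mult.assoc)
  have "c [^] (l - int n * q) = c [^] l" for l
    using assms by (simp add: int_pow_eq)
  then have "c [^] (i div 2 - int n * q) = c [^] (i div 2)"
    "c [^] (i div 2 - int n * q + 1) = c [^] (i div 2 + 1)"
    by (metis, metis add_diff_eq add.commute)
  moreover have "(i - 2 * t) div 2 = i div 2 - t" "even (i - 2 * t) = even i" for t
    by presburger+
  ultimately show ?thesis
    unfolding param_def i by simp
qed

text \<open>Parity of the index selects the coset, and inside a coset the direct decomposition of
  \<open>G\<close> determines \<open>a\<close> and the exponent of \<open>c\<close> modulo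
  \<open>n\<close>.\<close>

lemma bij_betw_param:
  assumes c: "c \<in> G" and ord: "ord c = n" and n: "n > 0"
    and A: "subgroup A D" "A \<subseteq> G"
    and prod: "generate D {c} <#> A = G" and int: "generate D {c} \<inter> A = {\<one>}"
  shows "bij_betw (param c) ({0..<2 * int n} \<times> A) (carrier D)"
proof -
  interpret A: subgroup A D by fact
  have gen: "generate D {c} = {c [^] l | l :: int. l \<in> UNIV}"
    using c by (intro generate_pow) simp
  \<comment> \<open>Equality of the two products puts \<open>c [^] (l - m)\<close> into both
    \<open>generate D {c}\<close> and \<open>A\<close>, whose intersection is trivial.\<close>
  have cancel: "int n dvd l - m \<and> a = b"
    if ab: "a \<in> A" "b \<in> A" and eq: "c [^] l \<otimes> a = c [^] m \<otimes> b" for l m :: int and a b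
  proof -
    have aG: "a \<in> G" "b \<in> G" using ab A by auto
    have "\<one> = c [^] l \<otimes> a \<otimes> inv (c [^] m \<otimes> b)"
      using aG c by (simp add: eq G_int_pow)
    also have "\<dots> = c [^] (l - m) \<otimes> (a \<otimes> inv b)"
      using aG c by (simp add: mult_inv_int_pow)
    finally have *: "c [^] (l - m) = inv (a \<otimes> inv b)"
      using aG c by (metis G_int_pow inv_equality m_closed m_inv_closed mem_carrier)
    moreover have "c [^] (l - m) \<in> generate D {c}" using gen by blast
    moreover have "inv (a \<otimes> inv b) \<in> A" using ab by simp
    ultimately have one: "c [^] (l - m) = \<one>" using int by auto
    then have "int n dvd l - m" using c ord by (simp add: int_pow_eq_id)
    moreover have "a \<otimes> inv b = \<one>"
      using * one aG by (metis inv_inv inv_one m_closed m_inv_closed mem_carrier)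
    then have "a = b"
      using aG by (metis inv_equality inv_inv m_inv_closed mem_carrier)
    ultimately show ?thesis by blast
  qed
  have decomp: "\<exists>l a. a \<in> A \<and> g = c [^] (l :: int) \<otimes> a" if "g \<in> G" for g
    using that gen unfolding prod[symmetric] set_mult_def by auto
  have PG: "c [^] (l :: int) \<otimes> a \<in> G" if "a \<in> A" for l a
    using that c A by (auto simp: G_int_pow)
  have "inj_on (param c) ({0..<2 * int n} \<times> A)"
  proof (rule inj_onI, clarify)
    fix i a j b
    assume ij: "i \<in> {0..<2 * int n}" "j \<in> {0..<2 * int n}" and ab: "a \<in> A" "b \<in> A"
      and eq: "param c (i, a) = param c (j, b)"
    have parity: "even i \<longleftrightarrow> even j"
      using eq ab PG x_mult_notin by (auto simp: param_def split: if_splits) metis+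
    have "int n dvd i div 2 - j div 2 \<and> a = b"
    proof (cases "even i")
      case True
      then show ?thesis
        using eq parity ab cancel by (simp add: param_def)
    next
      case False
      then have "c [^] (i div 2 + 1) \<otimes> a = c [^] (j div 2 + 1) \<otimes> b"
        using eq parity ab PG by (simp add: param_def x_carrier)
      then show ?thesis
        using ab cancel[of a b "i div 2 + 1" "j div 2 + 1"] by simp
    qed
    \<comment> \<open>Both halves lie in \<open>{0..<n}\<close>, so a difference divisible by
      \<open>n\<close> must vanish.\<close>
    moreover have "0 \<le> i div 2" "i div 2 < int n" "0 \<le> j div 2" "j div 2 < int n"
      using ij by auto
    then have "\<bar>i div 2 - j div 2\<bar> < int n"
      by linarith
    ultimately have "i div 2 = j div 2" "a = b"
      using dvd_imp_le_int[of "i div 2 - j div 2" "int n"] by auto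
    then show "i = j \<and> a = b"
      using parity by presburger
  qed
  moreover have "param c ` ({0..<2 * int n} \<times> A) = carrier D"
  proof (intro equalityI subsetI)
    fix d assume "d \<in> carrier D"
    have "\<exists>i a. a \<in> A \<and> d = param c (i, a)"
      using \<open>d \<in> carrier D\<close>
    proof (cases rule: carrier_cases)
      case rotation
      then show ?thesis using decomp[of d] by (metis param_even)
    next
      case (reflection g)
      then obtain l a where "a \<in> A" "g = c [^] (l :: int) \<otimes> a"
        using decomp by blast
      then show ?thesis
        \<comment> \<open>The index is built from \<open>l - 1\<close> to offset the
          \<open>m + 1\<close> in \<open>param_odd\<close>.\<close>
        using reflection param_odd[of c "l - 1" a]
          by (intro exI[of _ "2 * (l - 1) + 1"] exI[of _ a]) simp
    qed
    then obtain i a where "a \<in> A" "d = param c (i mod (2 * int n), a)"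
      using param_mod[OF c ord] by metis
    then show "d \<in> param c ` ({0..<2 * int n} \<times> A)"
      using n by auto
  qed (use PG x_carrier in \<open>auto simp: param_def\<close>)
  ultimately show ?thesis
    by (simp add: bij_betw_def)
qed

end

section \<open>The regular parametrization by the cyclic group times \<open>A\<close>\<close>

theorem theorem2p6:
  fixes D :: "('a, 'b) monoid_scheme"
    and G S A :: "'a set"
    and x c y :: 'a
    and k :: nat
  assumes "generalized_dihedral D G x"
    and "finite G"
    and "S \<subseteq> carrier D"
    and "set_inv\<^bsub>D\<^esub> S = S"
    and "c \<in> G"
    and "group.ord D c = 2 ^ k"
    and "subgroup A (D\<lparr>carrier := G\<rparr>)"
    and "internal_direct_product (D\<lparr>carrier := G\<rparr>) (generate D {c}) A"
    and "y \<in> x <#\<^bsub>D\<^esub> G"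
    and "\<And>g. g \<in> G \<Longrightarrow>
           y \<otimes>\<^bsub>D\<^esub> g \<in> S \<inter> (x <#\<^bsub>D\<^esub> G) \<longleftrightarrow>
           y \<otimes>\<^bsub>D\<^esub> inv\<^bsub>D\<^esub> g \<otimes>\<^bsub>D\<^esub> c \<in> S \<inter> (x <#\<^bsub>D\<^esub> G)"
  shows "Cayley_graph_on (Cay D S)
           (integer_mod_group (2 ^ (k + 1)) \<times>\<times> D\<lparr>carrier := A\<rparr>)"
proof -
  interpret X: generalized_dihedral D G x by fact
  interpret Y: generalized_dihedral D G y
    using assms by (intro X.generalized_dihedral_coset)
  define Z where "Z = integer_mod_group (2 ^ (k + 1))"
  define K where "K = Z \<times>\<times> D\<lparr>carrier := A\<rparr>"
  have A: "subgroup A D" "A \<subseteq> G"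
    using X.incl_subgroup[OF X.subgroup_axioms assms(7)] subgroup.subset[OF assms(7)] by auto
  interpret A: subgroup A D by (rule A(1))
  have grpA: "group (D\<lparr>carrier := A\<rparr>)"
    using A(1) by (rule X.subgroup_imp_group)
  have grpK: "group K"
    unfolding K_def Z_def by (intro DirProd_group grpA) simp
  have coset: "y \<otimes>\<^bsub>D\<^esub> g \<in> x <#\<^bsub>D\<^esub> G" if "g \<in> G" for g
    using assms(9) that X.x_carrier by (auto simp: l_coset_def X.m_assoc)
  \<comment> \<open>Both products lie in the coset by \<open>coset\<close>, so the assumption takes
    the form required by \<open>param_diff_mem_iff\<close> with \<open>y\<close> as the
    reflection.\<close>
  have hyp: "y \<otimes>\<^bsub>D\<^esub> g \<in> S \<longleftrightarrow> y \<otimes>\<^bsub>D\<^esub> inv\<^bsub>D\<^esub> g \<otimes>\<^bsub>D\<^esub> c \<in> S" if g: "g \<in> G" for g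
    using assms(10)[OF g] coset[OF g] coset[of "inv\<^bsub>D\<^esub> g \<otimes>\<^bsub>D\<^esub> c"] g assms(5) Y.x_carrier
    by (simp add: X.m_assoc)
  \<comment> \<open>The modulus is written as \<open>2 * int (2 ^ k)\<close> to match
    \<open>bij_betw_param\<close> and \<open>param_mod\<close> with \<open>n = 2 ^ k\<close>, the
    order of \<open>c\<close>.\<close>
  have carrier_K: "carrier K = {0..<2 * int (2 ^ k)} \<times> A"
    by (simp add: K_def Z_def DirProd_def carrier_integer_mod_group)
  have diff_K: "(i, a) \<otimes>\<^bsub>K\<^esub> inv\<^bsub>K\<^esub> (j, b) = ((i - j) mod (2 * int (2 ^ k)), a \<otimes>\<^bsub>D\<^esub> inv\<^bsub>D\<^esub> b)"
    if "(i, a) \<in> carrier K" "(j, b) \<in> carrier K" for i j a b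
  proof -
    have j: "j \<in> carrier Z" and b: "b \<in> A"
      using that by (auto simp: K_def)
    have "inv\<^bsub>K\<^esub> (j, b) = (inv\<^bsub>Z\<^esub> j, inv\<^bsub>D\<^esub> b)"
      using j b grpA A(1) by (simp add: K_def Z_def inv_DirProd X.m_inv_consistent)
    moreover have "i \<otimes>\<^bsub>Z\<^esub> inv\<^bsub>Z\<^esub> j = (i - j) mod (2 * int (2 ^ k))"
      using j by (simp add: Z_def mod_add_right_eq)
    ultimately show ?thesis
      by (simp add: K_def)
  qed
  have prod: "generate D {c} <#>\<^bsub>D\<^esub> A = G" "generate D {c} \<inter> A = {\<one>\<^bsub>D\<^esub>}"
    using assms(8) by (auto simp: internal_direct_product_def set_mult_def)
  have "Cayley_graph_on (Cay D S) K"
  proof (rule Cayley_graph_onI[where f = "Y.param c"])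
    show "bij_betw (Y.param c) (carrier K) (carrier D)"
      unfolding carrier_K using assms A prod by (intro Y.bij_betw_param) auto
    show "Y.param c \<one>\<^bsub>K\<^esub> = \<one>\<^bsub>D\<^esub>"
      by (simp add: K_def Z_def Y.param_def)
    fix u v assume uv: "u \<in> carrier K" "v \<in> carrier K"
    obtain j b i a where [simp]: "u = (j, b)" "v = (i, a)" by (cases u, cases v)
    have ab: "a \<in> G" "b \<in> G"
      using uv A(2) by (auto simp: carrier_K)
    show "Y.param c v \<otimes>\<^bsub>D\<^esub> inv\<^bsub>D\<^esub> Y.param c u \<in> S \<longleftrightarrow> Y.param c (v \<otimes>\<^bsub>K\<^esub> inv\<^bsub>K\<^esub> u) \<in> S"
      \<comment> \<open>Subtraction in \<open>K\<close> reduces the index modulo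
        \<open>2 ^ (k + 1)\<close>; \<open>param_mod\<close> removes this reduction and leaves the
        integer index \<open>i - j\<close>.\<close>
      using Y.param_diff_mem_iff[OF assms(4) hyp assms(5) ab] Y.param_mod[OF assms(5,6)] uv
      by (simp only: diff_K \<open>u = (j, b)\<close> \<open>v = (i, a)\<close>)
  qed (use assms grpK X.is_group in auto)
  then show ?thesis
    by (simp only: K_def Z_def)
qed

end
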